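(* Assume that $f(\bm{x})=\sum_{i=1}^N f_i(x_i)$ is $c_0$-strongly convex on $\mathbb{R}^{nN}$ for some $c_0>0$ and twice continuously differentiable, and that the graph $\mathcal{G}$ with Laplacian $L$ is strongly connected and weight-balanced; let $\bm{L}=L\otimes I_n$. Then there exists $\varepsilon_0>0$ such that for every fixed $\varepsilon\in(0,\varepsilon_0)$ the system $$\dot{\bm{x}}=-\nabla f(\bm{x})-\bm{\lambda},\qquad \varepsilon\dot{\bm{\lambda}}=-\bm{L}\bm{\lambda}+\varepsilon(\bm{x}-\bm{b})$$ has a unique equilibrium, i.e., there is a unique pair $(\bar{\bm{x}}(\varepsilon),\bar{\bm{\lambda}}(\varepsilon))\in\mathbb{R}^{nN}\times\mathbb{R}^{nN}$ satisfying $$0=\nabla f(\bm{x})+\bm{\lambda},\qquad 0=-\varepsilon(\bm{x}-\bm{b})+\bm{L}\bm{\lambda}.$$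
   Context: Setting: $N$ agents, each with a decision variable $x_i\in\mathbb{R}^n$, a cost function $f_i:\mathbb{R}^n\to\mathbb{R}$ and a vector $b_i\in\mathbb{R}^n$. Write $\bm{x}=(x_1^T,\dots,x_N^T)^T$, $\bm{\lambda}=(\lambda_1^T,\dots,\lambda_N^T)^T$, $\bm{b}=(b_1^T,\dots,b_N^T)^T\in\mathbb{R}^{nN}$, and $d=\sum_{i=1}^N b_i$. The resource allocation problem is to minimize $f(\bm{x})=\sum_{i=1}^N f_i(x_i)$ subject to $\sum_{i=1}^N x_i=d$. Graph: $\mathcal{G}$ is a weighted directed graph on $\{1,\dots,N\}$ with adjacency matrix $\mathcal{A}=[a_{ij}]$, where $a_{ij}>0$ if $(j,i)$ is an edge and $a_{ij}=0$ otherwise. Its Laplacian is $L=\mathcal{D}_{in}-\mathcal{A}$ with $\mathcal{D}_{in}=\mathrm{diag}(d_{in}^1,\dots,d_{in}^N)$, $d_{in}^i=\sum_j a_{ij}$. The graph is weight-balanced if $\sum_j a_{ij}=\sum_j a_{ji}$ for all $i$, and strongly connected if there is a directed path between every ordered pair of vertices. $\otimes$ is the Kronecker product and $I_n$ the $n\times n$ identity matrix. *)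

theory Defs
  imports "Graph_Theory.Pair_Digraph" "Graph_Theory.Digraph_Component" "HOL-Analysis.Analysis"
begin

text \<open>
  With \<open>'N\<close> indexing the agents and \<open>'n\<close> the coordinates of one decision variable, the space of
  stacked vectors is \<open>real ^ ('N \<times> 'n)\<close>: coordinate \<open>(i, k)\<close> is coordinate \<open>k\<close> of block \<open>i\<close>.
\<close>

definition stack :: "('N::finite \<Rightarrow> real ^ 'n::finite) \<Rightarrow> real ^ ('N \<times> 'n)" where
  "stack v = (\<chi> p. v (fst p) $ snd p)"

definition block :: "real ^ ('N::finite \<times> 'n::finite) \<Rightarrow> 'N \<Rightarrow> real ^ 'n" where
  "block x i = (\<chi> k. x $ (i, k))"

definition kronecker_product ::
  "real ^ 'b::finite ^ 'a::finite \<Rightarrow> real ^ 'd::finite ^ 'c::finite \<Rightarrow> real ^ ('b \<times> 'd) ^ ('a \<times> 'c)"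
  where
  "kronecker_product A B = (\<chi> p q. A $ fst p $ fst q * B $ snd p $ snd q)"

definition total_cost ::
  "('N::finite \<Rightarrow> real ^ 'n::finite \<Rightarrow> real) \<Rightarrow> real ^ ('N \<times> 'n) \<Rightarrow> real" where
  "total_cost fi x = (\<Sum>i\<in>UNIV. fi i (block x i))"

definition strongly_convex_on :: "'a::real_inner set \<Rightarrow> real \<Rightarrow> ('a \<Rightarrow> real) \<Rightarrow> bool" where
  "strongly_convex_on S c f \<longleftrightarrow> convex S \<and>
     (\<forall>x\<in>S. \<forall>y\<in>S. \<forall>t\<in>{0..1}.
        f (t *\<^sub>R x + (1 - t) *\<^sub>R y)
          \<le> t * f x + (1 - t) * f y - c / 2 * t * (1 - t) * (norm (x - y))\<^sup>2)"

definition twice_continuously_differentiable :: "('a::real_normed_vector \<Rightarrow> real) \<Rightarrow> bool" where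
  "twice_continuously_differentiable f \<longleftrightarrow>
     (\<exists>(f' :: 'a \<Rightarrow> 'a \<Rightarrow>\<^sub>L real) (f'' :: 'a \<Rightarrow> 'a \<Rightarrow>\<^sub>L ('a \<Rightarrow>\<^sub>L real)).
        (\<forall>x. (f has_derivative blinfun_apply (f' x)) (at x)) \<and>
        (\<forall>x. (f' has_derivative blinfun_apply (f'' x)) (at x)) \<and>
        continuous_on UNIV f'')"

text \<open>The value of \<open>gradient f x\<close> is meaningful only where \<open>f\<close> is differentiable.\<close>

definition gradient :: "('a::real_inner \<Rightarrow> real) \<Rightarrow> 'a \<Rightarrow> 'a" where
  "gradient f x = (THE D. GDERIV f x :> D)"

text \<open>
  Edge \<open>(j, i)\<close> has weight \<open>A $ i $ j\<close>: row \<open>i\<close> lists the weights of the edges entering \<open>i\<close>.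
\<close>

definition weighted_adjacency :: "'N::finite pair_pre_digraph \<Rightarrow> real ^ 'N ^ 'N \<Rightarrow> bool" where
  "weighted_adjacency G A \<longleftrightarrow>
     (\<forall>i j. ((j, i) \<in> parcs G \<longrightarrow> A $ i $ j > 0) \<and> ((j, i) \<notin> parcs G \<longrightarrow> A $ i $ j = 0))"

definition weight_balanced :: "real ^ 'N::finite ^ 'N \<Rightarrow> bool" where
  "weight_balanced A \<longleftrightarrow> (\<forall>i. (\<Sum>j\<in>UNIV. A $ i $ j) = (\<Sum>j\<in>UNIV. A $ j $ i))"

definition in_degree_matrix :: "real ^ 'N::finite ^ 'N \<Rightarrow> real ^ 'N ^ 'N" where
  "in_degree_matrix A = (\<chi> i j. if i = j then (\<Sum>k\<in>UNIV. A $ i $ k) else 0)"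

definition laplacian :: "real ^ 'N::finite ^ 'N \<Rightarrow> real ^ 'N ^ 'N" where
  "laplacian A = in_degree_matrix A - A"

text \<open>Trajectories of
  \<open>x' = - \<nabla>f(x) - l\<close>, \<open>\<epsilon> l' = - M l + \<epsilon> (x - b)\<close> and the stationary ones among them.\<close>

definition solves_system ::
  "(real ^ 'v::finite \<Rightarrow> real) \<Rightarrow> real ^ 'v ^ 'v \<Rightarrow> real ^ 'v \<Rightarrow> real \<Rightarrow>
     (real \<Rightarrow> real ^ 'v) \<Rightarrow> (real \<Rightarrow> real ^ 'v) \<Rightarrow> bool" where
  "solves_system f M b \<epsilon> x l \<longleftrightarrow>
     (\<exists>x' l'. \<forall>t.
        (x has_vector_derivative x' t) (at t) \<and>
        (l has_vector_derivative l' t) (at t) \<and>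
        x' t = - gradient f (x t) - l t \<and>
        \<epsilon> *\<^sub>R l' t = - (M *v l t) + \<epsilon> *\<^sub>R (x t - b))"

definition is_equilibrium ::
  "(real ^ 'v::finite \<Rightarrow> real) \<Rightarrow> real ^ 'v ^ 'v \<Rightarrow> real ^ 'v \<Rightarrow> real \<Rightarrow>
     real ^ 'v \<Rightarrow> real ^ 'v \<Rightarrow> bool" where
  "is_equilibrium f M b \<epsilon> x l \<longleftrightarrow> solves_system f M b \<epsilon> (\<lambda>_. x) (\<lambda>_. l)"

end

theory Submission
  imports Defs
begin

text \<open>
  The equilibrium equations say that the operator
  \<open>T(x, l) = (\<nabla>f(x) + l, M l - (x - b))\<close> vanishes, \<open>M\<close> being the lifted Laplacian divided by \<open>\<epsilon>\<close>.
  Weight balance makes \<open>M\<close> positive semidefinite, so \<open>T\<close> is monotone, and strongly so in \<open>x\<close>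
  by strong convexity; this gives uniqueness. For existence, Brouwer's theorem
  solves the variational inequality of \<open>T\<close> on a product of two balls. Testing it with \<open>(b, 0)\<close>
  yields \<open>\<parallel>x - b\<parallel> \<le> \<parallel>\<nabla>f(b)\<parallel> / c\<close>, so \<open>x\<close> is interior and \<open>l = -\<nabla>f(x)\<close>; hence \<open>l\<close> is bounded
  a priori, is interior for a large second ball, and \<open>T\<close> vanishes at the solution.
  Nothing here needs \<open>\<epsilon>\<close> to be small, so \<open>\<epsilon>0 = 1\<close> serves.
\<close>

section \<open>Variational inequalities on compact convex sets\<close>

text \<open>Brouwer yields a fixed point of \<open>z\<close> \<mapsto> \<open>P (z - T z)\<close>,
  with \<open>P\<close> the projection onto \<open>K\<close>; the obtuse-angle property of the
  projection turns the fixed-point equation into the inequality.\<close>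

lemma variational_inequality_solvable:
  fixes T :: "'a::euclidean_space \<Rightarrow> 'a"
  assumes "compact K" "convex K" "K \<noteq> {}" "continuous_on K T"
  obtains z where "z \<in> K" "\<And>w. w \<in> K \<Longrightarrow> T z \<bullet> (w - z) \<ge> 0"
proof -
  define P where "P = closest_point K"
  have "closed K"
    using assms(1) compact_imp_closed by blast
  have "continuous_on K (\<lambda>z. P (z - T z))"
    unfolding P_def
    by (rule continuous_on_compose2[OF continuous_on_closest_point[OF assms(2) \<open>closed K\<close> assms(3), of UNIV]])
       (auto intro!: continuous_intros assms(4))
  moreover have "(\<lambda>z. P (z - T z)) \<in> K \<rightarrow> K"
    unfolding P_def using closest_point_in_set[OF \<open>closed K\<close> assms(3)] by blast
  ultimately obtain z where z: "z \<in> K" "P (z - T z) = z"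
    by (rule brouwer[OF assms(1-3)])
  show thesis
  proof
    show "z \<in> K" by fact
    fix w assume "w \<in> K"
    from closest_point_dot[OF assms(2) \<open>closed K\<close> this, of "z - T z"] z(2)
    show "T z \<bullet> (w - z) \<ge> 0"
      by (simp add: P_def)
  qed
qed

text \<open>Were \<open>v\<close> nonzero, moving from \<open>z\<close> along \<open>-v\<close>
  inside the ball would make the inner product negative.\<close>

lemma inner_minimal_at_interior_imp_zero:
  fixes v z :: "'a::real_inner"
  assumes "z \<in> ball a r" "\<And>w. w \<in> cball a r \<Longrightarrow> v \<bullet> (w - z) \<ge> 0"
  shows "v = 0"
proof (rule ccontr)
  assume "v \<noteq> 0"
  \<comment> \<open>The displacement \<open>s *\<^sub>R v\<close> has length
    \<open>r - dist a z\<close>, the gap between \<open>z\<close> and the sphere.\<close>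
  define s where "s = (r - dist a z) / norm v"
  have s: "s > 0"
    using assms(1) \<open>v \<noteq> 0\<close> by (simp add: s_def)
  have "dist a (z - s *\<^sub>R v) \<le> dist a z + dist z (z - s *\<^sub>R v)"
    by (rule dist_triangle)
  also have "\<dots> = r"
    using assms(1) \<open>v \<noteq> 0\<close> by (simp add: dist_norm s_def)
  finally have "v \<bullet> (- (s *\<^sub>R v)) \<ge> 0"
    using assms(2)[of "z - s *\<^sub>R v"] by simp
  moreover have "s * (v \<bullet> v) > 0"
    using s \<open>v \<noteq> 0\<close> by simp
  ultimately show False
    by simp
qed

section \<open>Existence, uniqueness and continuity of gradients\<close>

lemma GDERIV_unique:
  assumes "GDERIV f x :> D" "GDERIV f x :> E"
  shows "D = E"
proof -
  have "(\<lambda>h. h \<bullet> D) = (\<lambda>h. h \<bullet> E)"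
    using has_derivative_unique assms unfolding gderiv_def by blast
  then show ?thesis
    by (metis vector_eq_ldot)
qed

lemma GDERIV_gradient:
  assumes "GDERIV f x :> D"
  shows "GDERIV f x :> gradient f x"
  unfolding gradient_def using assms by (rule theI) (rule GDERIV_unique[OF _ assms])

text \<open>Riesz representation of the derivative, written out in the standard basis.\<close>

lemma has_derivative_imp_GDERIV:
  fixes f :: "'a::euclidean_space \<Rightarrow> real"
  assumes "(f has_derivative f') (at x)"
  shows "GDERIV f x :> (\<Sum>i\<in>Basis. f' i *\<^sub>R i)"
proof -
  interpret linear f'
    using assms by (rule has_derivative_linear)
  have "f' h = h \<bullet> (\<Sum>i\<in>Basis. f' i *\<^sub>R i)" for h
  proof -
    have "f' h = f' (\<Sum>i\<in>Basis. (h \<bullet> i) *\<^sub>R i)"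
      by (simp add: euclidean_representation)
    also have "\<dots> = h \<bullet> (\<Sum>i\<in>Basis. f' i *\<^sub>R i)"
      by (simp add: sum scale inner_sum_right mult.commute)
    finally show ?thesis .
  qed
  then have "f' = (\<lambda>h. h \<bullet> (\<Sum>i\<in>Basis. f' i *\<^sub>R i))"
    by blast
  with assms show ?thesis
    unfolding gderiv_def by simp
qed

lemma twice_continuously_differentiable_gradient:
  fixes f :: "'a::euclidean_space \<Rightarrow> real"
  assumes "twice_continuously_differentiable f"
  shows "GDERIV f x :> gradient f x" "continuous_on UNIV (gradient f)"
proof -
  from assms obtain f' :: "'a \<Rightarrow> 'a \<Rightarrow>\<^sub>L real" and f''
    where f': "\<And>x. (f has_derivative blinfun_apply (f' x)) (at x)"
      and f'': "\<And>x. (f' has_derivative blinfun_apply (f'' x)) (at x)"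
    unfolding twice_continuously_differentiable_def by metis
  define g where "g x = (\<Sum>i\<in>Basis. f' x i *\<^sub>R i)" for x
  have g: "GDERIV f x :> g x" for x
    unfolding g_def by (rule has_derivative_imp_GDERIV[OF f'])
  show *: "GDERIV f x :> gradient f x" for x
    using g by (rule GDERIV_gradient)
  \<comment> \<open>Differentiability of \<open>f'\<close> makes it continuous, and its Riesz
    representative \<open>g\<close> inherits this.\<close>
  have "continuous_on UNIV f'"
    using f'' by (intro has_derivative_continuous_on) auto
  then have "continuous_on UNIV g"
    unfolding g_def by (intro continuous_intros)
  moreover have "gradient f = g"
    using GDERIV_unique[OF * g] by blast
  ultimately show "continuous_on UNIV (gradient f)"
    by simp
qed

section \<open>First-order consequences of strong convexity\<close>

text \<open>Divide the convexity inequality on the segment from \<open>x\<close> to \<open>y\<close>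
  by \<open>t\<close> and let \<open>t\<close> tend to 0 from the right: the difference quotient
  tends to the directional derivative.\<close>

lemma strongly_convex_on_gradient_ge:
  fixes f :: "'a::real_inner \<Rightarrow> real"
  assumes "strongly_convex_on S c f" "x \<in> S" "y \<in> S" "GDERIV f x :> D"
  shows "f y \<ge> f x + D \<bullet> (y - x) + c / 2 * (norm (y - x))\<^sup>2"
proof -
  define \<phi> where "\<phi> t = f (x + t *\<^sub>R (y - x))" for t :: real
  have "((\<lambda>t. x + t *\<^sub>R (y - x)) has_derivative (\<lambda>t. t *\<^sub>R (y - x))) (at 0)"
    by (auto intro!: derivative_eq_intros)
  moreover have "(f has_derivative (\<lambda>h. h \<bullet> D)) (at (x + 0 *\<^sub>R (y - x)))"
    using assms(4) by (simp add: gderiv_def)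
  ultimately have "(\<phi> has_derivative (\<lambda>t. (t *\<^sub>R (y - x)) \<bullet> D)) (at 0)"
    unfolding \<phi>_def by (rule has_derivative_compose)
  moreover have "(\<lambda>t. (t *\<^sub>R (y - x)) \<bullet> D) = (*) (D \<bullet> (y - x))"
    by (auto simp: inner_commute mult.commute)
  ultimately have "DERIV \<phi> 0 :> D \<bullet> (y - x)"
    by (simp add: has_field_derivative_def)
  then have "((\<lambda>t. (\<phi> t - \<phi> 0) / t) \<longlongrightarrow> D \<bullet> (y - x)) (at_right 0)"
    by (simp add: DERIV_def filterlim_at_split)
  moreover have "((\<lambda>t. f y - f x - c / 2 * (1 - t) * (norm (y - x))\<^sup>2)
      \<longlongrightarrow> f y - f x - c / 2 * (1 - 0) * (norm (y - x))\<^sup>2) (at_right 0)"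
    by (intro tendsto_intros)
  moreover have "eventually (\<lambda>t. (\<phi> t - \<phi> 0) / t \<le> f y - f x - c / 2 * (1 - t) * (norm (y - x))\<^sup>2)
      (at_right 0)"
    using eventually_at_right_real[OF zero_less_one]
  proof eventually_elim
    case (elim t)
    then have "t \<in> {0..1}"
      by auto
    moreover have "x + t *\<^sub>R (y - x) = t *\<^sub>R y + (1 - t) *\<^sub>R x"
      by (simp add: algebra_simps)
    ultimately have "\<phi> t \<le> t * f y + (1 - t) * f x - c / 2 * t * (1 - t) * (norm (y - x))\<^sup>2"
      using assms(1-3) unfolding strongly_convex_on_def \<phi>_def by metis
    then have "\<phi> t - \<phi> 0 \<le> (f y - f x - c / 2 * (1 - t) * (norm (y - x))\<^sup>2) * t"
      by (simp add: \<phi>_def algebra_simps)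
    with elim show ?case
      by (simp add: pos_divide_le_eq)
  qed
  ultimately have "D \<bullet> (y - x) \<le> f y - f x - c / 2 * (1 - 0) * (norm (y - x))\<^sup>2"
    using tendsto_le[OF trivial_limit_at_right_real] by blast
  then show ?thesis
    by simp
qed

text \<open>Add the first-order bounds at \<open>x\<close> and at \<open>y\<close>; the function
  values cancel.\<close>

lemma strongly_convex_on_gradient_strongly_monotone:
  fixes f :: "'a::real_inner \<Rightarrow> real"
  assumes "strongly_convex_on S c f" "x \<in> S" "y \<in> S" "GDERIV f x :> D" "GDERIV f y :> E"
  shows "(D - E) \<bullet> (x - y) \<ge> c * (norm (x - y))\<^sup>2"
  using strongly_convex_on_gradient_ge[OF assms(1-4)]
    strongly_convex_on_gradient_ge[OF assms(1,3,2,5)]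
  by (simp add: norm_minus_commute[of y x] inner_diff_left inner_diff_right)

section \<open>Positive semidefiniteness of the lifted Laplacian\<close>

text \<open>Twice the form equals the sum of \<open>A $ i $ j * (y i - y j)\<^sup>2\<close>, because
  balance gives both square terms of the expansion the same total.\<close>

lemma laplacian_quadratic_form_nonneg:
  fixes A :: "real ^ 'N::finite ^ 'N"
  assumes "weight_balanced A" "\<And>i j. A $ i $ j \<ge> 0"
  shows "(\<Sum>i\<in>UNIV. \<Sum>j\<in>UNIV. laplacian A $ i $ j * y i * y j) \<ge> 0"
proof -
  have "(\<Sum>i\<in>UNIV. \<Sum>j\<in>UNIV. laplacian A $ i $ j * y i * y j)
      = (\<Sum>i\<in>UNIV. (\<Sum>k\<in>UNIV. A $ i $ k) * (y i)\<^sup>2 - (\<Sum>j\<in>UNIV. A $ i $ j * y i * y j))"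
    by (simp add: laplacian_def in_degree_matrix_def left_diff_distrib sum_subtractf
        if_distrib[where f="\<lambda>x. x * _"] power2_eq_square mult.assoc cong: if_cong)
  also have "\<dots> = (\<Sum>i\<in>UNIV. \<Sum>j\<in>UNIV. A $ i $ j * (y i)\<^sup>2)
      - (\<Sum>i\<in>UNIV. \<Sum>j\<in>UNIV. A $ i $ j * y i * y j)"
    by (simp add: sum_subtractf sum_distrib_right)
  finally have 1: "(\<Sum>i\<in>UNIV. \<Sum>j\<in>UNIV. laplacian A $ i $ j * y i * y j)
      = (\<Sum>i\<in>UNIV. \<Sum>j\<in>UNIV. A $ i $ j * (y i)\<^sup>2)
        - (\<Sum>i\<in>UNIV. \<Sum>j\<in>UNIV. A $ i $ j * y i * y j)" .
  \<comment> \<open>Balance enters here: row sums are exchanged for column sums, then the summations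
    are swapped.\<close>
  have "(\<Sum>i\<in>UNIV. \<Sum>j\<in>UNIV. A $ i $ j * (y i)\<^sup>2)
      = (\<Sum>i\<in>UNIV. (\<Sum>j\<in>UNIV. A $ j $ i) * (y i)\<^sup>2)"
    using assms(1) by (simp add: weight_balanced_def flip: sum_distrib_right)
  also have "\<dots> = (\<Sum>i\<in>UNIV. \<Sum>j\<in>UNIV. A $ i $ j * (y j)\<^sup>2)"
    unfolding sum_distrib_right by (rule sum.swap)
  finally have 2: "(\<Sum>i\<in>UNIV. \<Sum>j\<in>UNIV. A $ i $ j * (y i)\<^sup>2)
      = (\<Sum>i\<in>UNIV. \<Sum>j\<in>UNIV. A $ i $ j * (y j)\<^sup>2)" .
  have "0 \<le> (\<Sum>i\<in>UNIV. \<Sum>j\<in>UNIV. A $ i $ j * (y i - y j)\<^sup>2)"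
    using assms(2) by (intro sum_nonneg) simp
  also have "\<dots> = (\<Sum>i\<in>UNIV. \<Sum>j\<in>UNIV. A $ i $ j * (y i)\<^sup>2 + A $ i $ j * (y j)\<^sup>2
      - 2 * (A $ i $ j * y i * y j))"
    by (simp add: power2_eq_square algebra_simps)
  also have "\<dots> = 2 * (\<Sum>i\<in>UNIV. \<Sum>j\<in>UNIV. laplacian A $ i $ j * y i * y j)"
    unfolding 1 using 2 by (simp add: sum.distrib sum_subtractf flip: sum_distrib_left)
  finally show ?thesis
    by simp
qed

text \<open>The identity factor never mixes coordinates, so the form splits into one copy of the
  form of \<open>B\<close> for each coordinate \<open>k\<close>.\<close>

lemma kronecker_product_mat_1_inner:
  fixes B :: "real ^ 'N::finite ^ 'N" and v :: "real ^ ('N \<times> 'n::finite)"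
  shows "(kronecker_product B (mat 1 :: real ^ 'n ^ 'n) *v v) \<bullet> v
    = (\<Sum>k\<in>UNIV. \<Sum>i\<in>UNIV. \<Sum>j\<in>UNIV. B $ i $ j * v $ (i, k) * v $ (j, k))"
proof -
  have "(kronecker_product B (mat 1 :: real ^ 'n ^ 'n) *v v) $ (i, k)
      = (\<Sum>j\<in>UNIV. B $ i $ j * v $ (j, k))" for i k
  proof -
    have "(kronecker_product B (mat 1 :: real ^ 'n ^ 'n) *v v) $ (i, k)
        = (\<Sum>j\<in>UNIV. \<Sum>m\<in>UNIV. if k = m then B $ i $ j * v $ (j, m) else 0)"
      unfolding sum.cartesian_product
      by (auto simp: kronecker_product_def matrix_vector_mult_def mat_def intro!: sum.cong)
    then show ?thesis
      by simp
  qed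
  then have "(kronecker_product B (mat 1 :: real ^ 'n ^ 'n) *v v) \<bullet> v
      = (\<Sum>i\<in>UNIV. \<Sum>k\<in>UNIV. (\<Sum>j\<in>UNIV. B $ i $ j * v $ (j, k)) * v $ (i, k))"
    unfolding inner_vec_def sum.cartesian_product by (auto intro!: sum.cong)
  then show ?thesis
    by (subst sum.swap) (simp add: sum_distrib_left sum_distrib_right mult_ac)
qed

lemma lifted_laplacian_inner_nonneg:
  fixes A :: "real ^ 'N::finite ^ 'N" and v :: "real ^ ('N \<times> 'n::finite)"
  assumes "weight_balanced A" "\<And>i j. A $ i $ j \<ge> 0"
  shows "(kronecker_product (laplacian A) (mat 1 :: real ^ 'n ^ 'n) *v v) \<bullet> v \<ge> 0"
  unfolding kronecker_product_mat_1_inner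
  by (intro sum_nonneg laplacian_quadratic_form_nonneg assms)

section \<open>Equilibria as solutions of algebraic equations\<close>

lemma is_equilibrium_iff:
  "is_equilibrium f M b \<epsilon> x l \<longleftrightarrow>
    0 = gradient f x + l \<and> 0 = - (\<epsilon> *\<^sub>R (x - b)) + M *v l"
proof -
  \<comment> \<open>Uniqueness of derivatives forces the velocity of a constant trajectory to be
    zero.\<close>
  have const: "((\<lambda>_. c) has_vector_derivative c') (at t) \<longleftrightarrow> c' = 0"
    for c c' :: "real ^ 'v::finite" and t :: real
    using vector_derivative_unique_at has_vector_derivative_const by blast
  show ?thesis
    unfolding is_equilibrium_def solves_system_def const
  proof (intro iffI; elim exE conjE)
    fix x' l' :: "real \<Rightarrow> real ^ 'a"
    assume "\<forall>t. x' t = 0 \<and> l' t = 0 \<and> x' t = - gradient f x - l \<and>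
      \<epsilon> *\<^sub>R l' t = - (M *v l) + \<epsilon> *\<^sub>R (x - b)"
    then have "0 = - gradient f x - l" "0 = - (M *v l) + \<epsilon> *\<^sub>R (x - b)"
      by (metis, metis scaleR_zero_right)
    then show "0 = gradient f x + l \<and> 0 = - (\<epsilon> *\<^sub>R (x - b)) + M *v l"
      by (simp add: algebra_simps eq_neg_iff_add_eq_0)
  next
    assume "0 = gradient f x + l" "0 = - (\<epsilon> *\<^sub>R (x - b)) + M *v l"
    then have "0 = - gradient f x - l" "0 = - (M *v l) + \<epsilon> *\<^sub>R (x - b)"
      by (simp_all add: algebra_simps eq_neg_iff_add_eq_0)
    then show "\<exists>x' l'. \<forall>t::real. x' t = 0 \<and> l' t = 0 \<and> x' t = - gradient f x - l \<and>
      \<epsilon> *\<^sub>R l' t = - (M *v l) + \<epsilon> *\<^sub>R (x - b)"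
      by (intro exI[of _ "\<lambda>_. 0"]) simp
  qed
qed

section \<open>Existence and uniqueness for the abstract saddle system\<close>

lemma saddle_system_solvable:
  fixes g :: "'a::euclidean_space \<Rightarrow> 'a" and M :: "'a \<Rightarrow> 'a"
  assumes "c > 0" "continuous_on UNIV g" "linear M"
    and mono: "\<And>x y. (g x - g y) \<bullet> (x - y) \<ge> c * (norm (x - y))\<^sup>2"
    and psd: "\<And>v. M v \<bullet> v \<ge> 0"
  obtains x l where "g x + l = 0" "M l = x - b"
proof -
  \<comment> \<open>The a priori bound on the distance of \<open>x\<close> from \<open>b\<close>,
    enlarged by 1 so that \<open>x\<close> lands strictly inside.\<close>
  define R where "R = norm (g b) / c + 1"
  have "compact (g ` cball b R)"
    using assms(2) by (intro compact_continuous_image) (auto intro: continuous_on_subset)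
  then have "bounded (g ` cball b R)"
    by (rule compact_imp_bounded)
  \<comment> \<open>\<open>B\<close> strictly bounds \<open>g\<close> on the first ball, so
    \<open>l = - g x\<close> will lie in the open second ball.\<close>
  then obtain B where B: "B > 0" "\<And>x. x \<in> cball b R \<Longrightarrow> norm (g x) < B"
    unfolding bounded_pos_less by blast
  have "R > 0"
    using assms(1) by (simp add: R_def add_nonneg_pos)
  define K where "K = cball b R \<times> cball (0::'a) B"
  define T where "T z = (g (fst z) + snd z, M (snd z) - (fst z - b))" for z
  have "continuous_on K T"
    unfolding T_def
    by (intro continuous_intros continuous_on_compose2[OF assms(2)]
        continuous_on_compose2[OF linear_continuous_on[of M UNIV]])
       (auto simp: assms(3) linear_linear)
  moreover have "compact K" "convex K" "K \<noteq> {}"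
    using \<open>R > 0\<close> \<open>B > 0\<close> by (auto simp: K_def compact_Times convex_Times)
  ultimately obtain z where z: "z \<in> K" "\<And>w. w \<in> K \<Longrightarrow> T z \<bullet> (w - z) \<ge> 0"
    using variational_inequality_solvable by blast
  obtain x l where xl: "z = (x, l)"
    by fastforce
  have vi: "(g x + l) \<bullet> (y - x) + (M l - (x - b)) \<bullet> (m - l) \<ge> 0"
    if "y \<in> cball b R" "m \<in> cball 0 B" for y m
    using z(2)[of "(y, m)"] that by (simp add: K_def T_def xl)
  have x: "x \<in> cball b R" and l: "l \<in> cball 0 B"
    using z(1) by (auto simp: K_def xl)
  \<comment> \<open>With the test point \<open>(b, 0)\<close> the cross terms between
    \<open>l\<close> and \<open>x - b\<close> cancel.\<close>
  have "g x \<bullet> (x - b) + M l \<bullet> l \<le> 0"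
    using vi[of b 0] \<open>R > 0\<close> \<open>B > 0\<close>
    by (simp add: inner_diff_left inner_diff_right inner_add_left inner_add_right inner_commute)
  with psd[of l] mono[of x b] have "c * (norm (x - b))\<^sup>2 \<le> - (g b \<bullet> (x - b))"
    by (simp add: inner_diff_left)
  also have "\<dots> \<le> norm (g b) * norm (x - b)"
    using norm_cauchy_schwarz[of "- g b" "x - b"] by simp
  finally have "norm (x - b) * (c * norm (x - b)) \<le> norm (x - b) * norm (g b)"
    by (simp add: power2_eq_square mult_ac)
  then have "c * norm (x - b) \<le> norm (g b)"
    by (cases "x = b") auto
  then have "norm (x - b) < R"
    using assms(1) by (simp add: R_def field_simps)
  then have "x \<in> ball b R"
    by (simp add: dist_norm norm_minus_commute)
  then have 1: "g x + l = 0"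
    \<comment> \<open>Testing with second component \<open>l\<close> isolates the first component of
      \<open>T\<close>.\<close>
    by (rule inner_minimal_at_interior_imp_zero) (use vi[OF _ l] in simp)
  then have "norm l = norm (g x)"
    by (metis add_eq_0_iff norm_minus_cancel)
  with B(2)[OF x] have "l \<in> ball 0 B"
    by simp
  then have "M l - (x - b) = 0"
    by (rule inner_minimal_at_interior_imp_zero) (use vi[OF x] in simp)
  with 1 that show thesis
    by simp
qed

text \<open>For two solutions the left side of \<open>mono\<close> equals
  \<open>- (M (l - m) \<bullet> (l - m))\<close>, which is at most 0. Hence \<open>x = y\<close>,
  and the first equation then determines \<open>l\<close>.\<close>

lemma saddle_system_unique:
  fixes g :: "'a::real_inner \<Rightarrow> 'a" and M :: "'a \<Rightarrow> 'a"
  assumes "c > 0" "linear M"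
    and mono: "\<And>x y. (g x - g y) \<bullet> (x - y) \<ge> c * (norm (x - y))\<^sup>2"
    and psd: "\<And>v. M v \<bullet> v \<ge> 0"
    and "g x + l = 0" "M l = x - b" "g y + m = 0" "M m = y - b"
  shows "x = y \<and> l = m"
proof -
  have "x - y = M (l - m)" "g x - g y = - (l - m)"
    using assms(5-8) by (simp_all add: linear_diff[OF assms(2)] add_eq_0_iff2)
  then have "(g x - g y) \<bullet> (x - y) = - (M (l - m) \<bullet> (l - m))"
    by (metis inner_commute inner_minus_left)
  with mono[of x y] psd[of "l - m"] have "c * (norm (x - y))\<^sup>2 \<le> 0"
    by linarith
  then have "x = y"
    using assms(1) by (simp add: mult_le_0_iff)
  with assms(5,7) show ?thesis
    by (metis add_left_cancel)
qed

theorem theorem1: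
  fixes fi :: "'N::finite \<Rightarrow> real ^ 'n::finite \<Rightarrow> real"
    and b :: "'N \<Rightarrow> real ^ 'n"
    and G :: "'N pair_pre_digraph"
    and A :: "real ^ 'N ^ 'N"
    and c0 :: real
  defines "f \<equiv> total_cost fi"
    and "bb \<equiv> stack b"
    and "LL \<equiv> kronecker_product (laplacian A) (mat 1 :: real ^ 'n ^ 'n)"
  assumes "c0 > 0"
    and "strongly_convex_on UNIV c0 f"
    and "twice_continuously_differentiable f"
    and "pverts G = UNIV"
    and "weighted_adjacency G A"
    and "strongly_connected (with_proj G)"
    and "weight_balanced A"
  shows "\<exists>\<epsilon>0>0. \<forall>\<epsilon>. 0 < \<epsilon> \<and> \<epsilon> < \<epsilon>0 \<longrightarrow>
    (\<exists>!(x, l). is_equilibrium f LL bb \<epsilon> x l) \<and>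
    (\<exists>!(x, l). 0 = gradient f x + l \<and> 0 = - (\<epsilon> *\<^sub>R (x - bb)) + LL *v l)"
proof (intro exI[of _ 1] conjI allI impI)
  show "(0::real) < 1"
    by simp
  fix \<epsilon> :: real
  assume "0 < \<epsilon> \<and> \<epsilon> < 1"
  then have "\<epsilon> > 0"
    by simp
  \<comment> \<open>Dividing by \<epsilon> brings the second equation into the form
    \<open>M l = x - bb\<close> of the saddle system; as \<epsilon> is positive, semidefiniteness
    survives.\<close>
  define M where "M v = (1 / \<epsilon>) *\<^sub>R (LL *v v)" for v
  have "linear M"
    unfolding M_def by (intro linear_compose_scale_right matrix_vector_mul_linear)
  have "A $ i $ j \<ge> 0" for i j
    using assms(8) unfolding weighted_adjacency_def by (metis less_eq_real_def)
  then have psd: "M v \<bullet> v \<ge> 0" for v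
    using lifted_laplacian_inner_nonneg[OF assms(10), of v] \<open>\<epsilon> > 0\<close> by (simp add: M_def LL_def)
  note grad = twice_continuously_differentiable_gradient[OF assms(6)]
  have mono: "(gradient f x - gradient f y) \<bullet> (x - y) \<ge> c0 * (norm (x - y))\<^sup>2" for x y
    using strongly_convex_on_gradient_strongly_monotone[OF assms(5) _ _ grad(1) grad(1)] by simp
  have eq: "0 = gradient f x + l \<and> 0 = - (\<epsilon> *\<^sub>R (x - bb)) + LL *v l \<longleftrightarrow>
      gradient f x + l = 0 \<and> M l = x - bb" for x l
  proof -
    have "\<epsilon> *\<^sub>R M l = LL *v l"
      using \<open>\<epsilon> > 0\<close> by (simp add: M_def)
    then have "M l = x - bb \<longleftrightarrow> LL *v l = \<epsilon> *\<^sub>R (x - bb)"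
      using \<open>\<epsilon> > 0\<close> by (metis scaleR_cancel_left less_irrefl)
    then show ?thesis
      by (simp add: eq_commute[of 0] add_eq_0_iff)
  qed
  obtain x l where xl: "gradient f x + l = 0" "M l = x - bb"
    using saddle_system_solvable[OF assms(4) grad(2) \<open>linear M\<close> mono psd] by blast
  have unique: "y = x \<and> m = l" if "gradient f y + m = 0" "M m = y - bb" for y m
    by (rule saddle_system_unique[OF assms(4) \<open>linear M\<close> mono psd that xl])
  have "\<exists>!(x, l). gradient f x + l = 0 \<and> M l = x - bb"
  proof (rule ex1I[of _ "(x, l)"])
    show "case (x, l) of (x, l) \<Rightarrow> gradient f x + l = 0 \<and> M l = x - bb"
      using xl by simp
  next
    fix p
    assume "case p of (x, l) \<Rightarrow> gradient f x + l = 0 \<and> M l = x - bb"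
    then show "p = (x, l)"
      using unique by (cases p) blast
  qed
  then show "\<exists>!(x, l). 0 = gradient f x + l \<and> 0 = - (\<epsilon> *\<^sub>R (x - bb)) + LL *v l"
    unfolding eq .
  then show "\<exists>!(x, l). is_equilibrium f LL bb \<epsilon> x l"
    unfolding is_equilibrium_iff .
qed

end
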